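(* Let $n,p\in\{1,2,3,\ldots\}$, let $A,B\in\mathbb{R}^{p\times n}$ with $\operatorname{rank}(A\ B)=p$, and let $G:\mathbb{R}^n\rightrightarrows\mathbb{R}^n$ be the linear relation with $\operatorname{gra} G=\{(x,x^* )\in\mathbb{R}^n\times\mathbb{R}^n\mid Ax+Bx^*=0\}$. Let $k$ be the number of positive eigenvalues (counting multiplicity) of $AB^{\intercal}+BA^{\intercal}$, let $v_1,\ldots,v_p$ be an orthonormal basis of $\mathbb{R}^p$ consisting of eigenvectors of $AB^{\intercal}+BA^{\intercal}$ with eigenvalues $\lambda_1,\ldots,\lambda_p$, where $\lambda_1,\ldots,\lambda_k>0$ and $\lambda_{k+1},\ldots,\lambda_p\le 0$, and let $V_g$ be the $(p-k)\times p$ matrix with rows $v_{k+1}^{\intercal},\ldots,v_p^{\intercal}$. Define the linear relations $\widetilde G,\widehat G:\mathbb{R}^n\rightrightarrows\mathbb{R}^n$ by $$\operatorname{gra}\widetilde G=\{(x,x^* )\mid V_gAx+V_gBx^*=0\},$$ $$\operatorname{gra}\widehat G=\{(B^{\intercal}u,-A^{\intercal}u)\mid u\in \mathbf{V_-}(BA^{\intercal})+\mathbf{V_0}(BA^{\intercal})\}.$$ Then the following are equivalent: (i) $G$ is monotone; (ii) $\widetilde G$ is monotone; (iii) $\widetilde G$ is maximally monotone; (iv) $\widehat G$ is maximally monotone; (v) $\dim\mathbf{V_+}(BA^{\intercal})=p-n$, equivalently, $AB^{\intercal}+BA^{\intercal}$ has exactly $p-n$ positive eigenvalues (counting multiplic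ity).
   Context: $\mathbb{R}^n$ carries the Euclidean inner product $\langle\cdot,\cdot\rangle$. A set-valued operator $T:\mathbb{R}^n\rightrightarrows\mathbb{R}^n$ is identified with its graph $\operatorname{gra}T=\{(x,x^* )\mid x^*\in Tx\}$; it is a linear relation if $\operatorname{gra}T$ is a linear subspace of $\mathbb{R}^n\times\mathbb{R}^n$. $T$ is monotone if $\langle x-y,x^*-y^*\rangle\ge0$ for all $(x,x^* ),(y,y^* )\in\operatorname{gra}T$, and maximally monotone if it is monotone and has no proper monotone extension (in the sense of graph inclusion, among all set-valued operators). For a square matrix $M$, $\mathbf{V_+}(M)$, $\mathbf{V_0}(M)$, $\mathbf{V_-}(M)$ denote the spans of the eigenvectors of the symmetric matrix $M+M^{\intercal}$ belonging to positive, zero, and negative eigenvalues, respectively. *)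

theory Defs
  imports "HOL-Analysis.Analysis" "HOL-Computational_Algebra.Polynomial"
begin

definition gra :: "(real^'n \<Rightarrow> (real^'n) set) \<Rightarrow> ((real^'n) \<times> (real^'n)) set" where
  "gra T = {(x, x'). x' \<in> T x}"

definition linear_relation :: "(real^'n \<Rightarrow> (real^'n) set) \<Rightarrow> bool" where
  "linear_relation T \<longleftrightarrow> subspace (gra T)"

definition monotone_op :: "(real^'n \<Rightarrow> (real^'n) set) \<Rightarrow> bool" where
  "monotone_op T \<longleftrightarrow>
     (\<forall>(x, x') \<in> gra T. \<forall>(y, y') \<in> gra T. (x - y) \<bullet> (x' - y') \<ge> 0)"

definition maximally_monotone :: "(real^'n \<Rightarrow> (real^'n) set) \<Rightarrow> bool" where
  "maximally_monotone T \<longleftrightarrow>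
     monotone_op T \<and> \<not> (\<exists>S. monotone_op S \<and> gra T \<subset> gra S)"

definition eigenvector :: "real^'p^'p \<Rightarrow> real \<Rightarrow> real^'p \<Rightarrow> bool" where
  "eigenvector M l v \<longleftrightarrow> v \<noteq> 0 \<and> M *v v = l *\<^sub>R v"

definition V_plus :: "real^'p^'p \<Rightarrow> (real^'p) set" where
  "V_plus M = span {v. \<exists>l>0. eigenvector (M + transpose M) l v}"

definition V_zero :: "real^'p^'p \<Rightarrow> (real^'p) set" where
  "V_zero M = span {v. eigenvector (M + transpose M) 0 v}"

definition V_minus :: "real^'p^'p \<Rightarrow> (real^'p) set" where
  "V_minus M = span {v. \<exists>l<0. eigenvector (M + transpose M) l v}"

definition charpoly :: "real^'p^'p \<Rightarrow> real poly" where
  "charpoly M = det (mat [:0, 1:] - (\<chi> i j. [:M $ i $ j:]))"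

(* Eigenvalues are counted with algebraic multiplicity. *)
definition num_pos_eigenvalues :: "real^'p^'p \<Rightarrow> nat" where
  "num_pos_eigenvalues M =
     (\<Sum>l\<in>{l. l > 0 \<and> poly (charpoly M) l = 0}. order l (charpoly M))"

(* The block matrix (A B). *)
definition hblock :: "real^'n^'p \<Rightarrow> real^'n^'p \<Rightarrow> real^('n + 'n)^'p" where
  "hblock A B = (\<chi> i j. case j of Inl a \<Rightarrow> A $ i $ a | Inr b \<Rightarrow> B $ i $ b)"

(* A matrix whose number of rows is not fixed by a type (and may be 0) is
   represented by the list of its rows. *)
definition rows_mult_mat :: "(real^'p) list \<Rightarrow> real^'n^'p \<Rightarrow> (real^'n) list" where
  "rows_mult_mat V A = map (\<lambda>r. r v* A) V"

definition rows_mult_vec :: "(real^'n) list \<Rightarrow> real^'n \<Rightarrow> real list" where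
  "rows_mult_vec N x = map (\<lambda>r. r \<bullet> x) N"

(* The basis is indexed by 1, ..., p, with p = CARD('p); the rows are
   v (k+1), ..., v p. *)
definition Vg_rows :: "(nat \<Rightarrow> real^'p) \<Rightarrow> nat \<Rightarrow> (real^'p) list" where
  "Vg_rows v k = map v [k + 1..<CARD('p) + 1]"

definition gra_G :: "real^'n^'p \<Rightarrow> real^'n^'p \<Rightarrow> ((real^'n) \<times> (real^'n)) set" where
  "gra_G A B = {(x, x'). A *v x + B *v x' = 0}"

definition gra_G_tilde ::
    "(real^'p) list \<Rightarrow> real^'n^'p \<Rightarrow> real^'n^'p \<Rightarrow> ((real^'n) \<times> (real^'n)) set" where
  "gra_G_tilde Vg A B =
     {(x, x'). map2 (+) (rows_mult_vec (rows_mult_mat Vg A) x)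
                        (rows_mult_vec (rows_mult_mat Vg B) x')
               = replicate (length Vg) 0}"

(* The + between the two subspaces is the elementwise sum of sets. *)
definition gra_G_hat :: "real^'n^'p \<Rightarrow> real^'n^'p \<Rightarrow> ((real^'n) \<times> (real^'n)) set" where
  "gra_G_hat A B =
     {(transpose B *v u, - (transpose A *v u)) | u.
        u \<in> V_minus (B ** transpose A) + V_zero (B ** transpose A)}"

lemma mem_gra_G_tilde:
  "(x, x') \<in> gra_G_tilde Vg A B \<longleftrightarrow> (\<forall>r\<in>set Vg. r \<bullet> (A *v x + B *v x') = 0)"
proof -
  have "(r v* A) \<bullet> x + (r v* B) \<bullet> x' = r \<bullet> (A *v x + B *v x')" for r
    by (simp add: dot_lmul_matrix inner_add_right)
  then show ?thesis
    unfolding gra_G_tilde_def rows_mult_vec_def rows_mult_mat_def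
    by (induction Vg) auto
qed

lemma linear_relation_G:
  assumes "gra T = gra_G A B" shows "linear_relation T"
proof -
  let ?f = "\<lambda>z. A *v fst z + B *v snd z"
  have "linear ?f"
    by (rule linearI) (simp_all add: matrix_vector_right_distrib matrix_vector_mult_scaleR
        scaleR_right_distrib)
  then have "subspace {z. ?f z = 0}"
    by (rule linear_subspace_kernel)
  moreover have "gra_G A B = {z. ?f z = 0}"
    unfolding gra_G_def by auto
  ultimately show ?thesis
    unfolding linear_relation_def assms by simp
qed

lemma linear_relation_G_tilde:
  assumes "gra T = gra_G_tilde Vg A B" shows "linear_relation T"
proof -
  let ?f = "\<lambda>r z. r \<bullet> (A *v fst z + B *v snd z)"
  have "linear (?f r)" for r
    by (rule linearI) (simp_all add: matrix_vector_right_distrib matrix_vector_mult_scaleR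
        inner_add_right distrib_left)
  then have "subspace {z. ?f r z = 0}" for r
    by (rule linear_subspace_kernel)
  then have "subspace (\<Inter>r\<in>set Vg. {z. ?f r z = 0})"
    by (intro subspace_Inter) blast
  moreover have "gra_G_tilde Vg A B = (\<Inter>r\<in>set Vg. {z. ?f r z = 0})"
    by (rule set_eqI) (simp add: mem_gra_G_tilde split_paired_all)
  ultimately show ?thesis
    unfolding linear_relation_def assms by simp
qed

lemma linear_relation_G_hat:
  assumes "gra T = gra_G_hat A B" shows "linear_relation T"
proof -
  let ?U = "V_minus (B ** transpose A) + V_zero (B ** transpose A)"
  let ?f = "\<lambda>u. (transpose B *v u, - (transpose A *v u))"
  have "?U = {x + y | x y. x \<in> V_minus (B ** transpose A) \<and> y \<in> V_zero (B ** transpose A)}"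
    unfolding set_plus_def by blast
  moreover have "subspace {x + y | x y. x \<in> V_minus (B ** transpose A) \<and> y \<in> V_zero (B ** transpose A)}"
    unfolding V_minus_def V_zero_def by (rule subspace_sums[OF subspace_span subspace_span])
  ultimately have "subspace ?U"
    by simp
  moreover have "linear ?f"
    by (rule linearI) (simp_all add: matrix_vector_right_distrib matrix_vector_mult_scaleR)
  ultimately have "subspace (?f ` ?U)"
    by (rule linear_subspace_image[rotated])
  moreover have "gra_G_hat A B = ?f ` ?U"
    unfolding gra_G_hat_def by blast
  ultimately show ?thesis
    unfolding linear_relation_def assms by simp
qed

end

theory Submission
  imports Defs
begin

text \<open>
  Let q(x, x') be the inner product of x and x', and let S be the symmetric matrix
  A B^T + B A^T. The form q has signature (n, n), so a subspace on which q is semidefinite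
  has dimension at most n; a monotone linear relation is a subspace on which q is
  nonnegative, and it is maximal iff its dimension is n (Minty). The map
  u -> (B^T u, A^T u) is injective by the rank hypothesis, pulls 2 q back to the quadratic
  form of S, and has the q-orthogonal complement of G as its range, while the q-orthogonal
  complement of the image N of the nonpositive eigenspaces is G~. Thus p - k = dim N is at
  most n, and G^ is N with the sign of its second component changed. If q is nonnegative on G,
  it stays nonnegative on the sum of G and the image of the positive eigenspaces, whence
  2n - p + k is at most n and so k = p - n. Conversely, if dim N = n then N is maximal among the
  subspaces on which q is nonpositive, which forces q to be nonnegative on its complement G~.
\<close>

section \<open>The form on pairs and its orthogonal complements\<close>

definition pair_form :: "('a::real_inner) \<times> 'a \<Rightarrow> real" where
  "pair_form z = fst z \<bullet> snd z"

text \<open>The polar form of \<open>pair_form\<close>, without the factor 1/2.\<close>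

definition pair_bilin :: "('a::real_inner) \<times> 'a \<Rightarrow> 'a \<times> 'a \<Rightarrow> real" where
  "pair_bilin z w = fst z \<bullet> snd w + snd z \<bullet> fst w"

definition pair_perp :: "(('a::real_inner) \<times> 'a) set \<Rightarrow> ('a \<times> 'a) set" where
  "pair_perp S = {z. \<forall>w\<in>S. pair_bilin w z = 0}"

lemma pair_form_add: "pair_form (z + w) = pair_form z + pair_form w + pair_bilin z w"
  by (simp add: pair_form_def pair_bilin_def algebra_simps inner_commute)

lemma pair_form_scaleR: "pair_form (c *\<^sub>R z) = c\<^sup>2 * pair_form z"
  by (simp add: pair_form_def power2_eq_square)

lemma pair_bilin_self: "pair_bilin z z = 2 * pair_form z"
  by (simp add: pair_form_def pair_bilin_def inner_commute)

lemma pair_bilin_commute: "pair_bilin z w = pair_bilin w z"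
  by (simp add: pair_bilin_def inner_commute)

lemma pair_bilin_add_right: "pair_bilin z (w + w') = pair_bilin z w + pair_bilin z w'"
  by (simp add: pair_bilin_def algebra_simps)

lemma pair_bilin_scaleR_right: "pair_bilin z (c *\<^sub>R w) = c * pair_bilin z w"
  by (simp add: pair_bilin_def algebra_simps)

lemma subspace_pair_perp: "subspace (pair_perp S)"
  unfolding pair_perp_def
proof (rule subspaceI)
  show "0 \<in> {z. \<forall>w\<in>S. pair_bilin w z = 0}"
    by (simp add: pair_bilin_def)
qed (simp_all add: pair_bilin_add_right pair_bilin_scaleR_right)

text \<open>Swapping the two components turns \<open>pair_bilin\<close> into the Euclidean inner
  product of the product space, so this complement is the swapped ordinary orthogonal
  complement.\<close>

lemma dim_pair_perp:
  fixes S :: "(('a::euclidean_space) \<times> 'a) set"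
  assumes "subspace S"
  shows "dim (pair_perp S) + dim S = 2 * DIM('a)"
proof -
  let ?C = "{y \<in> UNIV. \<forall>x\<in>S. orthogonal x y}"
  have lin: "linear (prod.swap :: 'a \<times> 'a \<Rightarrow> _)"
    by (rule linearI) auto
  have "pair_perp S = prod.swap ` ?C"
  proof -
    have iff: "z \<in> pair_perp S \<longleftrightarrow> prod.swap z \<in> ?C" for z
      by (auto simp: pair_perp_def pair_bilin_def orthogonal_def inner_prod_def)
    show ?thesis
    proof (intro set_eqI iffI)
      fix z assume "z \<in> pair_perp S"
      then have "prod.swap (prod.swap z) \<in> prod.swap ` ?C"
        unfolding iff by (rule imageI)
      then show "z \<in> prod.swap ` ?C" by simp
    next
      fix z assume "z \<in> prod.swap ` ?C"
      then obtain y where "z = prod.swap y" "y \<in> ?C" by (rule imageE)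
      then show "z \<in> pair_perp S" unfolding iff by simp
    qed
  qed
  then have "dim (pair_perp S) = dim ?C"
    using dim_image_eq[OF lin, of ?C] by (simp add: inj_on_subset[OF inj_swap])
  then show ?thesis
    using dim_subspace_orthogonal_to_vectors[OF assms subspace_UNIV] by simp
qed

section \<open>Dimension bounds for semidefinite subspaces\<close>

text \<open>A pair in S with component sum 0 has the shape (d, -d), where the form is minus the
  squared norm of d; nonnegativity forces d = 0.\<close>

lemma inj_on_sum_of_pair_form_nonneg:
  assumes "subspace S" "\<And>z. z \<in> S \<Longrightarrow> pair_form z \<ge> 0"
  shows "inj_on (\<lambda>z. fst z + snd z) S"
proof (rule inj_onI)
  fix z w assume "z \<in> S" "w \<in> S" and eq: "fst z + snd z = fst w + snd w"
  then have "pair_form (z - w) \<ge> 0"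
    using assms by (simp add: subspace_diff)
  moreover have s: "snd (z - w) = - fst (z - w)"
    using eq by (simp add: algebra_simps)
  ultimately have "fst (z - w) \<bullet> fst (z - w) \<le> 0"
    unfolding pair_form_def s inner_minus_right by linarith
  then have "fst (z - w) = 0"
    by (metis inner_eq_zero_iff inner_ge_zero order_antisym)
  with s show "z = w"
    by (simp add: prod_eq_iff)
qed

lemma linear_pair_sum: "linear (\<lambda>z. fst z + snd z :: 'a::real_vector)"
  by (rule linearI) (auto simp: algebra_simps)

lemma dim_image_pair_sum:
  fixes S :: "(('a::euclidean_space) \<times> 'a) set"
  assumes "subspace S" "\<And>z. z \<in> S \<Longrightarrow> pair_form z \<ge> 0"
  shows "dim ((\<lambda>z. fst z + snd z) ` S) = dim S"
  using inj_on_sum_of_pair_form_nonneg[OF assms] span_eq_iff[THEN iffD2, OF assms(1)]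
  by (intro dim_image_eq linear_pair_sum) metis

lemma dim_le_pair_form_nonneg:
  fixes S :: "(('a::euclidean_space) \<times> 'a) set"
  assumes "subspace S" "\<And>z. z \<in> S \<Longrightarrow> pair_form z \<ge> 0"
  shows "dim S \<le> DIM('a)"
  using dim_image_pair_sum[OF assms] dim_subset_UNIV by metis

text \<open>Negating the second component flips the sign of the form and keeps the
  dimension.\<close>

lemma dim_le_pair_form_nonpos:
  fixes S :: "(('a::euclidean_space) \<times> 'a) set"
  assumes "subspace S" "\<And>z. z \<in> S \<Longrightarrow> pair_form z \<le> 0"
  shows "dim S \<le> DIM('a)"
proof -
  let ?f = "\<lambda>z :: 'a \<times> 'a. (fst z, - snd z)"
  have lin: "linear ?f"
    by (rule linearI) auto
  have "inj_on ?f (span S)"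
    by (auto simp: inj_on_def prod_eq_iff)
  then have "dim (?f ` S) = dim S"
    by (rule dim_image_eq[OF lin])
  moreover have "dim (?f ` S) \<le> DIM('a)"
    using assms by (intro dim_le_pair_form_nonneg linear_subspace_image[OF lin])
      (auto simp: pair_form_def)
  ultimately show ?thesis by simp
qed

text \<open>A common vector is orthogonal to itself, so the form vanishes on it and positivity on T
  makes it 0: the sum is direct. Without cross terms the form stays nonnegative on the sum, and the
  bound for such subspaces applies.\<close>

lemma dim_orthogonal_sum:
  fixes S T :: "(('a::euclidean_space) \<times> 'a) set"
  assumes S: "subspace S" "\<And>z. z \<in> S \<Longrightarrow> pair_form z \<ge> 0"
    and T: "subspace T" "\<And>z. z \<in> T \<Longrightarrow> z \<noteq> 0 \<Longrightarrow> pair_form z > 0"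
    and perp: "S \<subseteq> pair_perp T"
  shows "dim S + dim T \<le> DIM('a)"
proof -
  have orth: "pair_bilin x y = 0" if "x \<in> S" "y \<in> T" for x y
    using perp that by (auto simp: pair_perp_def pair_bilin_commute[of x y])
  have T0: "pair_form z \<ge> 0" if "z \<in> T" for z
    using T(2)[OF that] by (cases "z = 0") (auto simp: pair_form_def)
  have "S \<inter> T \<subseteq> {0}"
    using orth T(2) by (force simp: pair_bilin_self)
  then have "dim (S \<inter> T) = 0"
    by simp
  then have "dim S + dim T = dim {x + y |x y. x \<in> S \<and> y \<in> T}"
    using dim_sums_Int[OF S(1) T(1)] by linarith
  also have "\<dots> \<le> DIM('a)"
  proof (rule dim_le_pair_form_nonneg[OF subspace_sums[OF S(1) T(1)]])
    fix z assume "z \<in> {x + y |x y. x \<in> S \<and> y \<in> T}"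
    then obtain x y where "z = x + y" "x \<in> S" "y \<in> T" by blast
    then show "pair_form z \<ge> 0"
      using S(2) T0 orth by (simp only: pair_form_add) simp
  qed
  finally show ?thesis .
qed

text \<open>Orthogonality removes the cross term, so adjoining z preserves semidefiniteness whenever
  the sign at z agrees with the sign on S. This serves both signs below.\<close>

lemma pair_form_span_insert:
  assumes "subspace S" "z \<in> pair_perp S" "w \<in> span (insert z S)"
  obtains s c where "s \<in> S" "pair_form w = pair_form s + c\<^sup>2 * pair_form z"
proof -
  obtain c where c: "w - c *\<^sub>R z \<in> S"
    using assms(1,3) by (metis span_breakdown_eq span_eq_iff)
  have "pair_bilin (w - c *\<^sub>R z) (c *\<^sub>R z) = 0"
    using c assms(2) by (simp add: pair_perp_def pair_bilin_scaleR_right)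
  then have "pair_form w = pair_form (w - c *\<^sub>R z) + c\<^sup>2 * pair_form z"
    using pair_form_add[of "w - c *\<^sub>R z" "c *\<^sub>R z"] by (simp add: pair_form_scaleR)
  with c show thesis
    using that[of "w - c *\<^sub>R z" c] by simp
qed

text \<open>A vector z of the complement with a negative value could be adjoined to S, giving a
  nonpositive subspace of one dimension too many.\<close>

lemma pair_form_nonneg_perp:
  fixes S :: "(('a::euclidean_space) \<times> 'a) set"
  assumes S: "subspace S" "\<And>z. z \<in> S \<Longrightarrow> pair_form z \<le> 0" and dim: "dim S = DIM('a)"
    and z: "z \<in> pair_perp S"
  shows "pair_form z \<ge> 0"
proof (rule ccontr)
  assume neg: "\<not> pair_form z \<ge> 0"
  have "z \<notin> S"
  proof
    assume "z \<in> S"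
    then have "pair_bilin z z = 0"
      using z by (simp add: pair_perp_def)
    with neg show False by (simp add: pair_bilin_self)
  qed
  then have "dim (span (insert z S)) = dim S + 1"
    using S(1) by (simp add: dim_insert span_eq_iff[THEN iffD2])
  moreover have "dim (span (insert z S)) \<le> DIM('a)"
  proof (rule dim_le_pair_form_nonpos[OF subspace_span])
    fix w assume "w \<in> span (insert z S)"
    from pair_form_span_insert[OF S(1) z this] show "pair_form w \<le> 0"
      using S(2) neg by (smt (verit) mult_nonneg_nonpos zero_le_power2)
  qed
  ultimately show False
    using dim by simp
qed

section \<open>Monotone and maximally monotone linear relations\<close>

lemma monotone_op_iff_pair_form:
  assumes "subspace (gra T)"
  shows "monotone_op T \<longleftrightarrow> (\<forall>z\<in>gra T. pair_form z \<ge> 0)"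
proof
  assume mono: "monotone_op T"
  have 0: "(0, 0) \<in> gra T"
    using subspace_0[OF assms] by (simp add: zero_prod_def)
  show "\<forall>z\<in>gra T. pair_form z \<ge> 0"
  proof
    fix z assume "z \<in> gra T"
    with mono 0 have "(fst z - 0) \<bullet> (snd z - 0) \<ge> 0"
      unfolding monotone_op_def by (metis (mono_tags, lifting) case_prodD prod.collapse)
    then show "pair_form z \<ge> 0"
      by (simp add: pair_form_def)
  qed
next
  assume nonneg: "\<forall>z\<in>gra T. pair_form z \<ge> 0"
  have "(x - y) \<bullet> (x' - y') \<ge> 0" if "(x, x') \<in> gra T" "(y, y') \<in> gra T" for x x' y y'
    using nonneg subspace_diff[OF assms that] by (auto simp: pair_form_def)
  then show "monotone_op T"
    by (auto simp: monotone_op_def)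
qed

lemma maximally_monotone_iff_dim:
  fixes T :: "real^'n \<Rightarrow> (real^'n) set"
  assumes sub: "subspace (gra T)" and mono: "monotone_op T"
  shows "maximally_monotone T \<longleftrightarrow> dim (gra T) = CARD('n)"
proof
  have nonneg: "pair_form z \<ge> 0" if "z \<in> gra T" for z
    using that mono monotone_op_iff_pair_form[OF sub] by blast
  have le: "dim (gra T) \<le> CARD('n)"
    using dim_le_pair_form_nonneg[OF sub nonneg] by simp
  show "dim (gra T) = CARD('n)" if max: "maximally_monotone T"
  proof (rule ccontr)
    assume "dim (gra T) \<noteq> CARD('n)"
    \<comment> \<open>The complement is then too large for the form to be nonpositive on it, and any \<open>z\<close> in it
      with a positive value can be adjoined to \<open>T\<close>.\<close>
    then have "dim (pair_perp (gra T)) > DIM(real^'n)"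
      using le dim_pair_perp[OF sub] by simp
    then obtain z where z: "z \<in> pair_perp (gra T)" "pair_form z > 0"
      using dim_le_pair_form_nonpos[OF subspace_pair_perp] by (meson not_le)
    have "z \<notin> gra T"
      using z by (auto simp: pair_perp_def pair_bilin_self)
    define S where "S = (\<lambda>x. {y. (x, y) \<in> span (insert z (gra T))})"
    have S: "gra S = span (insert z (gra T))"
      by (auto simp: S_def gra_def)
    have "monotone_op S"
      unfolding monotone_op_iff_pair_form[of S, unfolded S, OF subspace_span]
      using pair_form_span_insert[OF sub z(1)] nonneg z(2)
      by (metis add_nonneg_nonneg less_imp_le mult_nonneg_nonneg zero_le_power2)
    moreover have "gra T \<subset> gra S"
      using \<open>z \<notin> gra T\<close> unfolding S by (metis insert_subset psubsetI span_superset)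
    ultimately show False
      using max by (auto simp: maximally_monotone_def)
  qed
  show "maximally_monotone T" if dim: "dim (gra T) = CARD('n)"
    unfolding maximally_monotone_def
  proof (intro conjI mono notI)
    assume "\<exists>S. monotone_op S \<and> gra T \<subset> gra S"
    then obtain S y y' where S: "monotone_op S" "gra T \<subset> gra S"
      and y: "(y, y') \<in> gra S" "(y, y') \<notin> gra T"
      by auto
    \<comment> \<open>The extension \<open>S\<close> need not be linear, so dimensions cannot be
      compared. Instead, the component sums of the graph of \<open>T\<close> fill the whole space;
      the point of \<open>T\<close> with the same sum as (y, y') differs from it by some (d, -d),
      and monotonicity of \<open>S\<close> makes d vanish.\<close>
    have "dim ((\<lambda>z. fst z + snd z) ` gra T) = DIM(real^'n)"
      using dim_image_pair_sum[OF sub nonneg] dim by simp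
    then have "(\<lambda>z. fst z + snd z) ` gra T = UNIV"
      unfolding dim_eq_full
      unfolding span_eq_iff[THEN iffD2, OF linear_subspace_image[OF linear_pair_sum sub]] .
    then have "y + y' \<in> (\<lambda>z. fst z + snd z) ` gra T"
      by blast
    then obtain x x' where x: "(x, x') \<in> gra T" "y + y' = x + x'"
      by auto
    have "(y - x) \<bullet> (y' - x') \<ge> 0"
      using S x y unfolding monotone_op_def by blast
    moreover have eq: "y' - x' = - (y - x)"
      using x(2) by (simp add: algebra_simps)
    ultimately have "(y - x) \<bullet> (y - x) \<le> 0"
      unfolding eq inner_minus_right by linarith
    then have "y = x"
      using inner_gt_zero_iff[of "y - x"] by (simp add: not_less[symmetric])
    moreover have "y' = x'"
      using x(2) \<open>y = x\<close> by simp
    ultimately show False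
      using x(1) y(2) by simp
  qed
qed

section \<open>Bounding the number of positive eigenvalues\<close>

text \<open>Each term of the Leibniz formula is, up to sign, a product of \<open>CARD('p)\<close>
  entries of degree at most 1.\<close>

lemma degree_charpoly_le: "degree (charpoly M) \<le> CARD('p)" for M :: "real^'p^'p"
proof -
  let ?N = "mat [:0, 1:] - (\<chi> i j. [:M $ i $ j:])"
  have "degree (of_int (sign p) * (\<Prod>i\<in>UNIV. ?N $ i $ p i)) \<le> CARD('p)" for p
  proof -
    have "degree (\<Prod>i\<in>UNIV. ?N $ i $ p i) \<le> (\<Sum>i\<in>(UNIV::'p set). (degree \<circ> (\<lambda>i. ?N $ i $ p i)) i)"
      by (rule degree_prod_sum_le) simp
    also have "\<dots> \<le> (\<Sum>i\<in>(UNIV::'p set). 1)"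
      by (rule sum_mono) (auto simp: mat_def intro!: degree_diff_le)
    finally show ?thesis
      using degree_mult_le[of "of_int (sign p)" "\<Prod>i\<in>UNIV. ?N $ i $ p i"] by simp
  qed
  then show ?thesis
    unfolding charpoly_def det_def by (intro degree_sum_le) simp_all
qed

text \<open>Evaluation at x is a ring homomorphism, so it passes through the Leibniz
  formula.\<close>

lemma poly_charpoly: "poly (charpoly M) x = det (mat x - M)"
  unfolding charpoly_def det_def
  by (simp add: poly_sum poly_prod mat_def) (intro sum.cong prod.cong refl arg_cong2[of _ _ _ _ "(*)"]; simp)

lemma charpoly_nonzero: "charpoly M \<noteq> 0" for M :: "real^'p^'p"
proof
  \<comment> \<open>A number above the operator norm is not an eigenvalue.\<close>
  assume "charpoly M = 0"
  define x where "x = onorm ((*v) M) + 1"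
  have "det (mat x - M) = 0"
    using poly_charpoly[of M x] \<open>charpoly M = 0\<close> by simp
  then obtain w where w: "w \<noteq> 0" "(mat x - M) *v w = 0"
    using invertible_det_nz[of "mat x - M"] matrix_left_invertible_ker[of "mat x - M"]
    by (auto simp: invertible_left_inverse)
  have "mat x *v w = x *\<^sub>R w"
    by (simp add: vec_eq_iff matrix_vector_mult_def mat_def if_distrib if_distribR cong: if_cong)
  then have "M *v w = x *\<^sub>R w"
    using w(2) by (simp add: matrix_vector_mult_diff_rdistrib)
  then have "\<bar>x\<bar> * norm w \<le> onorm ((*v) M) * norm w"
    using onorm[OF matrix_vector_mul_bounded_linear, of M w] by simp
  then show False
    using w(1) by (simp add: x_def)
qed

lemma num_pos_eigenvalues_le: "num_pos_eigenvalues M \<le> CARD('p)" for M :: "real^'p^'p"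
proof -
  have "num_pos_eigenvalues M \<le> (\<Sum>l | poly (charpoly M) l = 0. order l (charpoly M))"
    unfolding num_pos_eigenvalues_def
    by (rule sum_mono2) (auto simp: poly_roots_finite[OF charpoly_nonzero])
  also have "\<dots> \<le> CARD('p)"
    using sum_order_le_degree[OF charpoly_nonzero] degree_charpoly_le le_trans by blast
  finally show ?thesis .
qed

section \<open>Coordinates in an orthonormal eigenbasis\<close>

locale orthonormal_eigenbasis =
  fixes I :: "'i set" and M :: "real^'p^'p" and v :: "'i \<Rightarrow> real^'p" and l :: "'i \<Rightarrow> real"
  assumes finite_index: "finite I"
    and orthonormal: "\<And>i j. i \<in> I \<Longrightarrow> j \<in> I \<Longrightarrow> v i \<bullet> v j = (if i = j then 1 else 0)"
    and spans: "span (v ` I) = UNIV"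
    and eigen: "\<And>i. i \<in> I \<Longrightarrow> eigenvector M (l i) (v i)"
begin

lemma inj_on_basis: "inj_on v I"
  by (rule inj_onI) (metis orthonormal zero_neq_one)

lemma expand: "u = (\<Sum>i\<in>I. (u \<bullet> v i) *\<^sub>R v i)"
proof -
  have "(\<Sum>b\<in>v ` I. (u \<bullet> b) *\<^sub>R b) = u"
    by (rule orthonormal_basis_expand)
      (auto simp: pairwise_def orthogonal_def orthonormal norm_eq_1 spans finite_index)
  then show ?thesis
    by (simp add: sum.reindex[OF inj_on_basis])
qed

lemma mult_expand: "M *v u = (\<Sum>i\<in>I. (l i * (u \<bullet> v i)) *\<^sub>R v i)"
proof -
  have "M *v u = (\<Sum>i\<in>I. M *v ((u \<bullet> v i) *\<^sub>R v i))"
    by (subst expand[of u]) (rule linear_sum[OF matrix_vector_mul_linear, unfolded o_def])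
  also have "\<dots> = (\<Sum>i\<in>I. (l i * (u \<bullet> v i)) *\<^sub>R v i)"
    using eigen by (intro sum.cong) (auto simp: matrix_vector_mult_scaleR eigenvector_def)
  finally show ?thesis .
qed

lemma quadratic_form: "u \<bullet> (M *v u) = (\<Sum>i\<in>I. l i * (u \<bullet> v i)\<^sup>2)"
  unfolding mult_expand by (simp add: inner_sum_right power2_eq_square mult.assoc)

lemma inner_mult_basis: "i \<in> I \<Longrightarrow> (M *v u) \<bullet> v i = l i * (u \<bullet> v i)"
  unfolding mult_expand inner_sum_left using finite_index
  by (simp add: orthonormal if_distrib sum.delta cong: sum.cong if_cong)

lemma mem_span_iff:
  assumes "J \<subseteq> I"
  shows "u \<in> span (v ` J) \<longleftrightarrow> (\<forall>i\<in>I - J. u \<bullet> v i = 0)"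
proof
  assume "u \<in> span (v ` J)"
  moreover have "subspace {u. \<forall>i\<in>I - J. u \<bullet> v i = 0}"
    by (auto simp: subspace_def inner_add_left)
  moreover have "v ` J \<subseteq> {u. \<forall>i\<in>I - J. u \<bullet> v i = 0}"
    using assms orthonormal by auto
  ultimately show "\<forall>i\<in>I - J. u \<bullet> v i = 0"
    using span_minimal by blast
next
  assume "\<forall>i\<in>I - J. u \<bullet> v i = 0"
  then have "u = (\<Sum>i\<in>J. (u \<bullet> v i) *\<^sub>R v i)"
    using expand[of u] sum.mono_neutral_left[OF finite_index assms, of "\<lambda>i. (u \<bullet> v i) *\<^sub>R v i"]
    by simp
  then show "u \<in> span (v ` J)"
    by (metis (no_types, lifting) imageI span_base span_scale span_sum)
qed

lemma dim_span_basis: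
  assumes "J \<subseteq> I"
  shows "dim (span (v ` J)) = card J"
proof -
  have "independent (v ` J)"
  proof (rule pairwise_orthogonal_independent)
    show "pairwise orthogonal (v ` J)"
      using assms orthonormal by (auto simp: pairwise_def orthogonal_def subset_iff)
    show "0 \<notin> v ` J"
      using assms eigen by (auto simp: eigenvector_def)
  qed
  then show ?thesis
    using inj_on_subset[OF inj_on_basis assms] by (simp add: dim_eq_card_independent card_image)
qed

text \<open>If w is an eigenvector for m, comparing coordinates gives m * c = \<open>l i\<close> * c
  for its i-th coordinate c, so only basis vectors with \<open>l i\<close> = m contribute. The
  predicate P covers positive, zero and negative eigenvalues at once.\<close>

lemma span_eigenvectors:
  "span {w. \<exists>m. P m \<and> eigenvector M m w} = span (v ` {i \<in> I. P (l i)})"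
proof (rule span_eq[THEN iffD2], intro conjI subsetI)
  fix w assume "w \<in> {w. \<exists>m. P m \<and> eigenvector M m w}"
  then obtain m where m: "P m" "M *v w = m *\<^sub>R w"
    by (auto simp: eigenvector_def)
  have "w \<bullet> v i = 0" if "i \<in> I" "\<not> P (l i)" for i
  proof -
    have "m * (w \<bullet> v i) = l i * (w \<bullet> v i)"
      using inner_mult_basis[OF that(1), of w] m(2) by simp
    then show ?thesis
      using m(1) that(2) by auto
  qed
  then show "w \<in> span (v ` {i \<in> I. P (l i)})"
    by (subst mem_span_iff) auto
qed (auto intro!: span_base dest: eigen)

end

section \<open>The rank hypothesis and the equivalences\<close>

text \<open>Full row rank means that the transpose is injective, and the transpose sends u to
  \<open>u v* A\<close> stacked on \<open>u v* B\<close>.\<close>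

lemma hblock_full_rank_inj:
  fixes A B :: "real^'n^'p"
  assumes "rank (hblock A B) = CARD('p)" "u v* A = 0" "u v* B = 0"
  shows "u = 0"
proof -
  have "inj ((*v) (transpose (hblock A B)))"
    using assms(1) by (simp only: full_rank_injective[symmetric] rank_transpose)
  moreover have "transpose (hblock A B) *v u = 0"
  proof -
    have "(u v* hblock A B) $ j = 0" for j
      using assms(2,3)
      by (cases j) (auto simp: hblock_def vector_matrix_mult_def vec_eq_iff)
    then show ?thesis
      by (simp add: vec_eq_iff)
  qed
  ultimately show ?thesis
    by (metis injD matrix_vector_mult_0_right)
qed

theorem theorem3p3:
  fixes A B :: "real^'n^'p"
    and G Gt Gh :: "real^'n \<Rightarrow> (real^'n) set"
    and k :: nat
    and v :: "nat \<Rightarrow> real^'p"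
    and l :: "nat \<Rightarrow> real"
  assumes rank_AB: "rank (hblock A B) = CARD('p)"
    and G: "gra G = gra_G A B"
    and k: "k = num_pos_eigenvalues (A ** transpose B + B ** transpose A)"
    and orthonormal: "\<forall>i\<in>{1..CARD('p)}. \<forall>j\<in>{1..CARD('p)}. v i \<bullet> v j = (if i = j then 1 else 0)"
    and basis: "span (v ` {1..CARD('p)}) = UNIV"
    and eigen: "\<forall>i\<in>{1..CARD('p)}. eigenvector (A ** transpose B + B ** transpose A) (l i) (v i)"
    and pos: "\<forall>i\<in>{1..k}. l i > 0"
    and nonpos: "\<forall>i\<in>{k + 1..CARD('p)}. l i \<le> 0"
    and Gt: "gra Gt = gra_G_tilde (Vg_rows v k) A B"
    and Gh: "gra Gh = gra_G_hat A B"
  shows "(monotone_op G \<longleftrightarrow> monotone_op Gt)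
       \<and> (monotone_op Gt \<longleftrightarrow> maximally_monotone Gt)
       \<and> (maximally_monotone Gt \<longleftrightarrow> maximally_monotone Gh)
       \<and> (maximally_monotone Gh \<longleftrightarrow>
            int (dim (V_plus (B ** transpose A))) = int CARD('p) - int CARD('n))
       \<and> (int (dim (V_plus (B ** transpose A))) = int CARD('p) - int CARD('n) \<longleftrightarrow>
            int (num_pos_eigenvalues (A ** transpose B + B ** transpose A))
              = int CARD('p) - int CARD('n))"
proof -
  define S where "S = A ** transpose B + B ** transpose A"
  \<comment> \<open>\<open>V_plus\<close>, \<open>V_zero\<close> and \<open>V_minus\<close>
    symmetrise their argument, so at \<open>B ** transpose A\<close> they are spanned by
    eigenvectors of \<open>S\<close>.\<close>
  have S_eq: "B ** transpose A + transpose (B ** transpose A) = S"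
    by (simp add: S_def matrix_transpose_mul add.commute)
  interpret orthonormal_eigenbasis "{1..CARD('p)}" S v l
    using orthonormal basis eigen by unfold_locales (auto simp: S_def)
  let ?Ip = "{1..k}" and ?Im = "{k + 1..CARD('p)}"
  \<comment> \<open>With this bound the sign hypotheses alone give the number of positive \<open>l i\<close>, so that
    \<open>charpoly\<close> need not be factored.\<close>
  have k_le: "k \<le> CARD('p)"
    unfolding k by (rule num_pos_eigenvalues_le)
  have sign: "l i > 0 \<longleftrightarrow> i \<le> k" if "i \<in> {1..CARD('p)}" for i
    using that pos nonpos by (cases "i \<le> k") (auto simp: not_le not_less)
  have Ip: "{i \<in> {1..CARD('p)}. l i > 0} = ?Ip"
    using sign k_le by auto
  have Im: "{i \<in> {1..CARD('p)}. l i \<le> 0} = ?Im"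
    using sign by (auto simp: not_less[symmetric])
  define Up Um where "Up = span (v ` ?Ip)" and "Um = span (v ` ?Im)"
  have "V_plus (B ** transpose A) = Up"
    unfolding V_plus_def S_eq span_eigenvectors Up_def Ip ..
  then have dim_V_plus: "dim (V_plus (B ** transpose A)) = k"
    unfolding Up_def using k_le by (simp add: dim_span_basis del: dim_span)
  have dim_Up: "dim Up = k" and dim_Um: "dim Um = CARD('p) - k"
    unfolding Up_def Um_def using k_le by (simp_all add: dim_span_basis del: dim_span)
  have V_nonpos: "V_minus (B ** transpose A) + V_zero (B ** transpose A) = Um"
  proof -
    have zero: "V_zero (B ** transpose A) = span (v ` {i \<in> {1..CARD('p)}. l i = 0})"
      unfolding V_zero_def S_eq using span_eigenvectors[of "\<lambda>m. m = 0"] by simp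
    \<comment> \<open>The elementwise sum of two spans is the span of the union of their
      generators.\<close>
    have "V_minus (B ** transpose A) + V_zero (B ** transpose A)
      = span (v ` {i \<in> {1..CARD('p)}. l i < 0} \<union> v ` {i \<in> {1..CARD('p)}. l i = 0})"
      unfolding zero unfolding V_minus_def S_eq span_eigenvectors span_Un set_plus_def by blast
    also have "\<dots> = span (v ` {i \<in> {1..CARD('p)}. l i \<le> 0})"
      by (rule arg_cong[of _ _ span]) (auto simp: le_less)
    finally show ?thesis
      by (simp only: Im Um_def)
  qed
  \<comment> \<open>With B in the first component, pairing \<open>?f u\<close> with (x, x') gives
    the inner product of u with Ax + Bx', as \<open>bilin_f\<close> records.\<close>
  let ?f = "\<lambda>u. (u v* B, u v* A)"
  have lin: "linear ?f"
    by (rule linearI) (auto simp: scaleR_vector_matrix_assoc algebra_simps)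
  have inj: "inj ?f"
    unfolding linear_injective_0[OF lin] using hblock_full_rank_inj[OF rank_AB] by (auto simp: zero_prod_def)
  have dim_f: "dim (?f ` U) = dim U" for U
    using inj by (intro dim_image_eq[OF lin]) (rule inj_on_subset, auto)
  have form_f: "2 * pair_form (?f u) = (\<Sum>i\<in>{1..CARD('p)}. l i * (u \<bullet> v i)\<^sup>2)" for u
  proof -
    \<comment> \<open>The two summands of \<open>S\<close> contribute the same number, whence the
      factor 2.\<close>
    have "u \<bullet> (S *v u) = 2 * ((u v* B) \<bullet> (u v* A))"
      unfolding S_def
      by (simp add: matrix_vector_mult_add_rdistrib inner_add_right matrix_vector_mul_assoc[symmetric]
          dot_lmul_matrix[symmetric] inner_commute)
    then show ?thesis
      by (simp add: quadratic_form pair_form_def)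
  qed
  have sub_Up: "subspace (?f ` Up)" and sub_Um: "subspace (?f ` Um)"
    unfolding Up_def Um_def by (simp_all add: linear_subspace_image[OF lin])
  have form_Um: "pair_form z \<le> 0" if z: "z \<in> ?f ` Um" for z
  proof -
    obtain u where u: "z = ?f u" "\<forall>i\<in>{1..CARD('p)} - ?Im. u \<bullet> v i = 0"
      using z mem_span_iff[of ?Im] unfolding Um_def by auto
    have "2 * pair_form z \<le> 0"
      unfolding u(1) form_f
    proof (rule sum_nonpos)
      fix i assume "i \<in> {1..CARD('p)}"
      then show "l i * (u \<bullet> v i)\<^sup>2 \<le> 0"
        using u(2) nonpos by (cases "i \<in> ?Im") (auto simp: mult_nonpos_nonneg)
    qed
    then show ?thesis by simp
  qed
  have form_Up: "pair_form z > 0" if z: "z \<in> ?f ` Up" "z \<noteq> 0" for z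
  proof -
    obtain u where u: "z = ?f u" "\<forall>i\<in>{1..CARD('p)} - ?Ip. u \<bullet> v i = 0"
      using z(1) mem_span_iff[of ?Ip] k_le unfolding Up_def by auto
    then have "u \<noteq> 0"
      using z(2) by (auto simp: zero_prod_def)
    \<comment> \<open>Coordinates beyond k vanish on \<open>Up\<close>, so a nonzero coordinate has
      a positive eigenvalue and makes the sum strictly positive.\<close>
    then obtain j where j: "j \<in> {1..CARD('p)}" "u \<bullet> v j \<noteq> 0"
      using expand[of u] by (metis (no_types, lifting) scaleR_eq_0_iff sum.neutral)
    have "0 < 2 * pair_form z"
      unfolding u(1) form_f
    proof (rule sum_pos2[OF _ j(1)])
      have "j \<in> ?Ip" using u(2) j by blast
      then show "0 < l j * (u \<bullet> v j)\<^sup>2"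
        using pos j(2) by simp
      fix i assume "i \<in> {1..CARD('p)}"
      then show "0 \<le> l i * (u \<bullet> v i)\<^sup>2"
        using u(2) pos by (cases "i \<in> ?Ip") (auto simp: less_imp_le)
    qed simp
    then show ?thesis by simp
  qed
  have bilin_f: "pair_bilin (?f u) (x, x') = u \<bullet> (A *v x + B *v x')" for u x x'
    by (simp add: pair_bilin_def dot_lmul_matrix inner_add_right)
  have gra_G_eq: "gra G = pair_perp (range ?f)"
  proof -
    have "A *v x + B *v x' = 0 \<longleftrightarrow> (\<forall>u. u \<bullet> (A *v x + B *v x') = 0)" for x x'
      by (metis inner_eq_zero_iff inner_zero_right)
    then show ?thesis
      unfolding G gra_G_def pair_perp_def by (auto simp: bilin_f)
  qed
  have gra_Gt_eq: "gra Gt = pair_perp (?f ` Um)"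
  proof -
    have "(\<forall>r\<in>v ` ?Im. r \<bullet> y = 0) \<longleftrightarrow> (\<forall>r\<in>Um. r \<bullet> y = 0)" for y
    proof
      assume "\<forall>r\<in>v ` ?Im. r \<bullet> y = 0"
      then have "v ` ?Im \<subseteq> {r. r \<bullet> y = 0}" by blast
      moreover have "subspace {r. r \<bullet> y = 0}"
        by (auto simp: subspace_def inner_add_left)
      ultimately show "\<forall>r\<in>Um. r \<bullet> y = 0"
        unfolding Um_def using span_minimal by blast
    qed (auto simp: Um_def span_base)
    \<comment> \<open>If k = p the list of rows is empty and \<open>Um\<close> is {0}; both sides
      then describe the whole space.\<close>
    moreover have "set (Vg_rows v k) = v ` ?Im"
      by (simp add: Vg_rows_def atLeastLessThanSuc_atLeastAtMost del: upt_Suc)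
    ultimately show ?thesis
      unfolding Gt by (auto simp: mem_gra_G_tilde pair_perp_def bilin_f)
  qed
  let ?h = "\<lambda>u. (u v* B, - (u v* A))"
  have gra_Gh_eq: "gra Gh = ?h ` Um"
    unfolding Gh gra_G_hat_def V_nonpos by auto
  have sub_G: "subspace (gra G)" and sub_Gt: "subspace (gra Gt)" and sub_Gh: "subspace (gra Gh)"
    using linear_relation_G[OF G] linear_relation_G_tilde[OF Gt] linear_relation_G_hat[OF Gh]
    by (simp_all add: linear_relation_def)
  have lin_h: "linear ?h"
    by (rule linearI) (auto simp: scaleR_vector_matrix_assoc algebra_simps)
  have "inj ?h"
    using inj by (auto simp: inj_def)
  then have dim_Gh: "dim (gra Gh) = CARD('p) - k"
    unfolding gra_Gh_eq dim_Um[symmetric]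
    by (intro dim_image_eq[OF lin_h]) (rule inj_on_subset, auto)
  \<comment> \<open>The sign change in \<open>?h\<close> turns nonpositivity on the image of
    \<open>Um\<close> into monotonicity, so only the dimension of \<open>gra Gh\<close> decides
    maximality.\<close>
  have mono_Gh: "monotone_op Gh"
    unfolding monotone_op_iff_pair_form[OF sub_Gh] gra_Gh_eq
    using form_Um by (auto simp: pair_form_def)
  have Um_le: "CARD('p) - k \<le> CARD('n)"
    using dim_le_pair_form_nonpos[OF sub_Um form_Um] by (simp add: dim_f dim_Um)
  have dim_Gt: "dim (gra Gt) + (CARD('p) - k) = 2 * CARD('n)"
    using dim_pair_perp[OF sub_Um] by (simp add: gra_Gt_eq dim_f dim_Um)
  have dim_G: "dim (gra G) + CARD('p) = 2 * CARD('n)"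
    using dim_pair_perp[OF linear_subspace_image[OF lin subspace_UNIV]]
    by (simp add: gra_G_eq dim_f)
  \<comment> \<open>Integers are used because p may be smaller than n; \<open>k_le\<close> makes the
    natural subtraction p - k exact.\<close>
  let ?v = "int k = int CARD('p) - int CARD('n)"
  have v_iff: "?v \<longleftrightarrow> CARD('p) - k = CARD('n)"
    using k_le by auto
  have G_v: "?v" if "monotone_op G"
  proof -
    have "dim (gra G) + dim (?f ` Up) \<le> DIM(real^'n)"
    proof (rule dim_orthogonal_sum[OF sub_G _ sub_Up form_Up])
      show "pair_form z \<ge> 0" if "z \<in> gra G" for z
        using \<open>monotone_op G\<close> that by (simp add: monotone_op_iff_pair_form[OF sub_G])
      show "gra G \<subseteq> pair_perp (?f ` Up)"
        unfolding gra_G_eq pair_perp_def by blast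
    qed
    \<comment> \<open>Here (2n - p) + k is at most n, so k is at most p - n; \<open>Um_le\<close> is
      the reverse inequality.\<close>
    then show ?thesis
      using dim_G Um_le k_le by (simp add: dim_f dim_Up)
  qed
  have mono_Gt: "monotone_op Gt" if ?v
  proof -
    have "dim (?f ` Um) = DIM(real^'n)"
      using that v_iff by (simp add: dim_f dim_Um)
    then show ?thesis
      unfolding monotone_op_iff_pair_form[OF sub_Gt] gra_Gt_eq
      using pair_form_nonneg_perp[OF sub_Um form_Um] by blast
  qed
  have Gt_v: "maximally_monotone Gt" if ?v
    using maximally_monotone_iff_dim[OF sub_Gt mono_Gt[OF that]] that dim_Gt v_iff by simp
  \<comment> \<open>Complements reverse inclusion, so \<open>gra G\<close> is contained in
    \<open>gra Gt\<close>.\<close>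
  have Gt_G: "monotone_op G" if "monotone_op Gt"
    using that unfolding monotone_op_iff_pair_form[OF sub_Gt] monotone_op_iff_pair_form[OF sub_G]
    unfolding gra_G_eq gra_Gt_eq pair_perp_def by blast
  have Gt_max: "monotone_op Gt" if "maximally_monotone Gt"
    using that by (simp add: maximally_monotone_def)
  have Gh_v: "maximally_monotone Gh \<longleftrightarrow> ?v"
    using maximally_monotone_iff_dim[OF sub_Gh mono_Gh] dim_Gh v_iff by simp
  \<comment> \<open>The cycle runs from G monotone through \<open>?v\<close>, Gt maximal and Gt
    monotone back to G monotone; \<open>Gh_v\<close> attaches Gh to \<open>?v\<close>. Both versions
    of (v) have become \<open>?v\<close>.\<close>
  show ?thesis
    unfolding dim_V_plus k[symmetric] using G_v Gt_v Gt_G Gt_max Gh_v by blast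
qed

end
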